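(* Let $N\ge 1$, let $m_0,\dots,m_N>0$, $I_0,\dots,I_N>0$, $a_0>0$, $c_1,\dots,c_N>0$, $a_1,\dots,a_N\in\mathbb{R}$, and put $$J=I_0+m_0a_0^2,\quad b=m_0a_0,\quad m=\sum_{i=0}^N m_i,\quad \mu_i=\frac{1}{c_i^2}\big(I_i+m_ia_i(a_i-2c_i)\big).$$ For $\boldsymbol{\varphi}=(\varphi_1,\dots,\varphi_N)$ put $$\theta_i=(-1)^{i+1}\varphi_i+2\sum_{j=1}^{i-1}(-1)^{j+1}\varphi_j,\qquad \Phi_0(\boldsymbol{\varphi})=m+\sum_{i=1}^N\mu_i\sin^2\theta_i>0 .$$ Consider the following autonomous system of ordinary differential equations for the angles $(\vartheta,\varphi_1,\dots,\varphi_N)\in(\mathbb{R}/2\pi\mathbb{Z})^{N+1}$, where the prime denotes $d/d\tau$: $$\vartheta'=-\frac{b}{J}\sin\vartheta,\qquad \varphi_i'=\frac{(-1)^i}{c_i}\cos\vartheta\,\sin\theta_i-\frac{\sqrt{\Phi_0(\boldsymbol{\varphi})}}{\sqrt{J}}\sin\vartheta,\quad i=1,\dots,N.$$ Its fixed points are the $2^{N+1}$ points with $\vartheta\in\{0,\pi\}$ and $\sin\theta_i=0$ for $i=1,\dots,N$. Then the fixed point $\vartheta=0$, $\boldsymbol{\varphi}=0$ is a stable node and the fixed point $\vartheta=\pi$, $\boldsymbol{\varphi}=0$ is an unstable node. All the other fixed points are of saddle type and hence unstable.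
   Context: The system describes the inertial motion (rotor at rest) of an $(N+1)$-link wheeled vehicle on a fixed positive level set of its energy integral, after a rescaling of time. Here $m_i$ and $I_i$ are the mass and the central moment of inertia of the $i$th platform, $a_0$ is the distance from the center of mass of the leading platform (the Chaplygin sleigh) to its wheel pair, $c_i$ is the distance from a hinge of the $i$th trailer platform to its wheel pair, $a_i$ ($i\ge1$) is the distance of the center of mass of the $i$th platform from its right hinge, and $\varphi_i$ is the angle between the $i$th trailer platform and the leading platform. The type of a fixed point is determined by the linearization of the system at that point: it is a stable (respectively unstable) node if all eigenvalues of the linearization matrix are real and negative (respectively positive); it is of saddle type if all eigenvalues are real and nonzero and both signs occur. *)

theory Defs
  imports
    Complex_Main
    "HOL-Library.Real_Mod"
    "HOL-Analysis.L2_Norm"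
    "Jordan_Normal_Form.Char_Poly"
begin

text \<open>
  Points of the torus \<open>(\<real>/2\<pi>\<int>)\<^sup>n\<close> are represented by their lifts, real vectors of dimension
  \<open>n\<close>; two lifts describe the same point iff they are related by \<open>torus_rel n\<close>. The quotient map
  is a local isometry, so linearization and stability may be read off at any lift.
\<close>

definition torus_rel :: "nat \<Rightarrow> (real vec \<times> real vec) set" where
  "torus_rel n = {(x, y). x \<in> carrier_vec n \<and> y \<in> carrier_vec n \<and>
                          (\<forall>i<n. [x $ i = y $ i] (rmod (2 * pi)))}"

lemma equiv_torus_rel: "equiv (carrier_vec n) (torus_rel n)"
  by (rule equivI) (auto simp: torus_rel_def refl_on_def sym_def trans_def rcong_def)

definition vdist :: "nat \<Rightarrow> real vec \<Rightarrow> real vec \<Rightarrow> real" where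
  "vdist n x y = L2_set (\<lambda>i. x $ i - y $ i) {..<n}"

definition fixed_points :: "nat \<Rightarrow> (real vec \<Rightarrow> real vec) \<Rightarrow> real vec set" where
  "fixed_points n F = {p \<in> carrier_vec n. F p = 0\<^sub>v n}"

definition linearization_matrix ::
  "nat \<Rightarrow> (real vec \<Rightarrow> real vec) \<Rightarrow> real vec \<Rightarrow> real mat \<Rightarrow> bool" where
  "linearization_matrix n F p A \<longleftrightarrow> A \<in> carrier_mat n n \<and>
     (\<forall>i<n. \<forall>j<n. ((\<lambda>s. F (p + s \<cdot>\<^sub>v unit_vec n j) $ i) has_real_derivative A $$ (i, j)) (at 0))"

definition complex_eigenvalues :: "real mat \<Rightarrow> complex set" where
  "complex_eigenvalues A = {z. eigenvalue (map_mat complex_of_real A) z}"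

definition stable_node :: "nat \<Rightarrow> (real vec \<Rightarrow> real vec) \<Rightarrow> real vec \<Rightarrow> bool" where
  "stable_node n F p \<longleftrightarrow> p \<in> fixed_points n F \<and>
     (\<exists>A. linearization_matrix n F p A \<and>
          (\<forall>z\<in>complex_eigenvalues A. z \<in> \<real> \<and> Re z < 0))"

definition unstable_node :: "nat \<Rightarrow> (real vec \<Rightarrow> real vec) \<Rightarrow> real vec \<Rightarrow> bool" where
  "unstable_node n F p \<longleftrightarrow> p \<in> fixed_points n F \<and>
     (\<exists>A. linearization_matrix n F p A \<and>
          (\<forall>z\<in>complex_eigenvalues A. z \<in> \<real> \<and> Re z > 0))"

definition saddle_type :: "nat \<Rightarrow> (real vec \<Rightarrow> real vec) \<Rightarrow> real vec \<Rightarrow> bool" where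
  "saddle_type n F p \<longleftrightarrow> p \<in> fixed_points n F \<and>
     (\<exists>A. linearization_matrix n F p A \<and>
          (\<forall>z\<in>complex_eigenvalues A. z \<in> \<real> \<and> z \<noteq> 0) \<and>
          (\<exists>z\<in>complex_eigenvalues A. Re z < 0) \<and>
          (\<exists>z\<in>complex_eigenvalues A. Re z > 0))"

definition solves_ode_on ::
  "nat \<Rightarrow> (real vec \<Rightarrow> real vec) \<Rightarrow> real \<Rightarrow> (real \<Rightarrow> real vec) \<Rightarrow> bool" where
  "solves_ode_on n F T u \<longleftrightarrow>
     (\<forall>t\<in>{0..T}. u t \<in> carrier_vec n \<and>
        (\<forall>i<n. ((\<lambda>s. u s $ i) has_real_derivative F (u t) $ i) (at t within {0..T})))"

text \<open>Stability in the sense of Lyapunov, in forward time.\<close>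

definition lyapunov_stable :: "nat \<Rightarrow> (real vec \<Rightarrow> real vec) \<Rightarrow> real vec \<Rightarrow> bool" where
  "lyapunov_stable n F p \<longleftrightarrow>
     (\<forall>\<epsilon>>0. \<exists>\<delta>>0. \<forall>T\<ge>0. \<forall>u. solves_ode_on n F T u \<and> vdist n (u 0) p < \<delta> \<longrightarrow>
        (\<forall>t\<in>{0..T}. vdist n (u t) p < \<epsilon>))"

text \<open>
  The state is \<open>x = (\<vartheta>, \<phi>\<^sub>1, \<dots>, \<phi>\<^sub>N)\<close>, that is \<open>x $ 0 = \<vartheta>\<close> and \<open>x $ i = \<phi>\<^sub>i\<close>
  for \<open>1 \<le> i \<le> N\<close>. In \<open>m\<close>, \<open>I\<close> and \<open>a\<close> the index \<open>0\<close> refers to the leading platform;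
  \<open>c 0\<close> and the entry \<open>mu m I a c 0\<close> are never used.
\<close>

definition sleigh_J :: "(nat \<Rightarrow> real) \<Rightarrow> (nat \<Rightarrow> real) \<Rightarrow> (nat \<Rightarrow> real) \<Rightarrow> real" where
  "sleigh_J m I a = I 0 + m 0 * (a 0)\<^sup>2"

definition sleigh_b :: "(nat \<Rightarrow> real) \<Rightarrow> (nat \<Rightarrow> real) \<Rightarrow> real" where
  "sleigh_b m a = m 0 * a 0"

definition mu ::
  "(nat \<Rightarrow> real) \<Rightarrow> (nat \<Rightarrow> real) \<Rightarrow> (nat \<Rightarrow> real) \<Rightarrow> (nat \<Rightarrow> real) \<Rightarrow> nat \<Rightarrow> real" where
  "mu m I a c i = 1 / (c i)\<^sup>2 * (I i + m i * a i * (a i - 2 * c i))"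

definition theta :: "real vec \<Rightarrow> nat \<Rightarrow> real" where
  "theta x i = (-1) ^ (i + 1) * x $ i + 2 * (\<Sum>j=1..<i. (-1) ^ (j + 1) * x $ j)"

definition Phi0 ::
  "nat \<Rightarrow> (nat \<Rightarrow> real) \<Rightarrow> (nat \<Rightarrow> real) \<Rightarrow> (nat \<Rightarrow> real) \<Rightarrow> (nat \<Rightarrow> real) \<Rightarrow> real vec \<Rightarrow> real" where
  "Phi0 N m I a c x = (\<Sum>i=0..N. m i) + (\<Sum>i=1..N. mu m I a c i * (sin (theta x i))\<^sup>2)"

definition vehicle_field ::
  "nat \<Rightarrow> (nat \<Rightarrow> real) \<Rightarrow> (nat \<Rightarrow> real) \<Rightarrow> (nat \<Rightarrow> real) \<Rightarrow> (nat \<Rightarrow> real) \<Rightarrow> real vec \<Rightarrow> real vec" where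
  "vehicle_field N m I a c x = vec (N + 1) (\<lambda>i.
     if i = 0 then - (sleigh_b m a / sleigh_J m I a) * sin (x $ 0)
     else (-1) ^ i / c i * cos (x $ 0) * sin (theta x i)
          - sqrt (Phi0 N m I a c x) / sqrt (sleigh_J m I a) * sin (x $ 0))"

text \<open>The field depends only on the angles modulo \<open>2\<pi>\<close>, so it is a field on the torus.\<close>

lemma rcong_two_pi_iff: "[x = y] (rmod (2 * pi)) \<longleftrightarrow> (\<exists>k::int. x = y + 2 * pi * k)"
  by (subst rcong_sym_iff) (auto simp: rcong_altdef algebra_simps)

lemma theta_rcong:
  assumes "(x, y) \<in> torus_rel (N + 1)" and "i \<le> N"
  shows "[theta x i = theta y i] (rmod (2 * pi))"
proof -
  have "\<forall>i. \<exists>k::int. i \<le> N \<longrightarrow> x $ i = y $ i + 2 * pi * k"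
    using assms(1) by (auto simp: torus_rel_def rcong_two_pi_iff less_Suc_eq_le)
  then obtain k :: "nat \<Rightarrow> int" where k: "\<And>i. i \<le> N \<Longrightarrow> x $ i = y $ i + 2 * pi * k i"
    by metis
  define K :: int where "K = (-1) ^ (i + 1) * k i + 2 * (\<Sum>j=1..<i. (-1) ^ (j + 1) * k j)"
  have "(\<Sum>j=1..<i. (-1) ^ (j + 1) * x $ j)
        = (\<Sum>j=1..<i. (-1) ^ (j + 1) * y $ j + 2 * pi * ((-1) ^ (j + 1) * k j))"
    using assms(2) by (intro sum.cong refl) (simp add: k algebra_simps)
  also have "\<dots> = (\<Sum>j=1..<i. (-1) ^ (j + 1) * y $ j)
                  + 2 * pi * (\<Sum>j=1..<i. (-1) ^ (j + 1) * k j)"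
    by (simp only: sum.distrib sum_distrib_left of_int_sum of_int_mult of_int_power
        of_int_minus of_int_1)
  finally have "theta x i = theta y i + 2 * pi * K"
    using assms(2) by (simp add: theta_def K_def k algebra_simps)
  then show ?thesis
    unfolding rcong_two_pi_iff by blast
qed

lemma vehicle_field_torus:
  assumes "(x, y) \<in> torus_rel (N + 1)"
  shows "vehicle_field N m I a c x = vehicle_field N m I a c y"
proof -
  have s: "sin (theta x i) = sin (theta y i)" if "i \<le> N" for i
    using theta_rcong[OF assms that] by (rule sin_rcong)
  have P: "Phi0 N m I a c x = Phi0 N m I a c y"
    by (simp add: Phi0_def s)
  have 0: "[x $ 0 = y $ 0] (rmod (2 * pi))"
    using assms by (auto simp: torus_rel_def)
  show ?thesis
    unfolding vehicle_field_def
    by (rule eq_vecI) (use s P sin_rcong[OF 0] cos_rcong[OF 0] in auto)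
qed

end

theory Submission
  imports "HOL-Probability.Discrete_Topology" Defs
begin

unbundle no vec_syntax

text \<open>
  The angle \<open>\<theta>\<^sub>i\<close> is \<open>\<plusminus>\<phi>\<^sub>i\<close> plus twice a signed sum of the earlier angles. If the
  earlier angles are multiples of \<open>\<pi>\<close>, the doubled sum is a multiple of \<open>2\<pi>\<close>, so
  \<open>sin \<theta>\<^sub>i = \<plusminus> sin \<phi>\<^sub>i\<close> and \<open>cos \<theta>\<^sub>i = cos \<phi>\<^sub>i\<close> (\<open>sin_theta_cos_theta\<close>). By induction on
  \<open>i\<close> the fixed points are exactly the points all of whose coordinates are multiples of \<open>\<pi>\<close>;
  modulo \<open>2\<pi>\<close> there are \<open>2\<^sup>N\<^sup>+\<^sup>1\<close> of them.

  The vector field has a triangular structure at a fixed point: \<open>\<theta>\<^sub>i\<close> depends on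
  \<open>\<phi>\<^sub>1, \<dots>, \<phi>\<^sub>i\<close> only, and the term with the root of \<open>\<Phi>\<^sub>0\<close>, which couples all the angles, carries
  the factor \<open>sin \<vartheta> = 0\<close> and so contributes only to the column of \<open>\<vartheta>\<close>. The linearization matrix
  is therefore lower triangular, and its eigenvalues are the diagonal entries
  \<open>- (b / J) cos \<vartheta>\<close> and \<open>- cos \<vartheta> cos \<phi>\<^sub>i / c\<^sub>i\<close>. All cosines are \<open>\<plusminus>1\<close>. The eigenvalues are all
  negative if \<open>\<vartheta> = 0\<close> and all \<open>\<phi>\<^sub>i = 0\<close>, all positive if \<open>\<vartheta> = \<pi>\<close> and all \<open>\<phi>\<^sub>i = 0\<close>; as soon as
  one \<open>\<phi>\<^sub>i\<close> equals \<open>\<pi>\<close>, its eigenvalue and that of \<open>\<vartheta>\<close> have opposite signs.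

  Instability of the saddles follows because the triangular structure persists beyond the
  linearization. Let \<open>\<rho> > 0\<close> be the eigenvalue belonging to
  coordinate \<open>i\<close>, and keep the earlier coordinates at their values at the fixed point, which is
  consistent with the system. The displacement \<open>w\<close> of coordinate \<open>i\<close> from the fixed point then
  satisfies the scalar equation \<open>w' = \<rho> sin w\<close> exactly, whatever the later
  coordinates do, and \<open>\<bar>w\<bar>\<close> grows exponentially as long as \<open>\<bar>w\<bar> \<le> 1\<close>
  (\<open>not_lyapunov_stable_if_expanding_coordinate\<close>). It remains to know that such solutions exist
  for long times. The field is globally Lipschitz, since \<open>\<Phi>\<^sub>0\<close> stays between \<open>m\<^sub>0 > 0\<close> and a
  constant, so that the global form of the Picard-Lindeloef theorem (\<open>picard_lindelof_lipschitz\<close>)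
  applies.
\<close>

section \<open>Solutions of globally Lipschitz differential equations\<close>

text \<open>
  The integral operator of the equation need not contract in the sup norm on all of \<open>[0, T]\<close>. It
  does in the norm \<open>sup\<^sub>t e\<^sup>-\<^sup>\<kappa>\<^sup>t \<bar>u t\<bar>\<close> with \<open>\<kappa> > L\<close>, where its Lipschitz constant is \<open>L / \<kappa>\<close>; so a
  single application of Banach's fixed point theorem covers an interval of any length. The weight
  is absorbed into the unknown: the fixed point \<open>v\<close> is \<open>v t = e\<^sup>-\<^sup>\<kappa>\<^sup>t u t\<close>.
\<close>
lemma picard_lindelof_lipschitz:
  fixes F :: "'b::banach \<Rightarrow> 'b"
  assumes lip: "L-lipschitz_on UNIV F" and T: "T \<ge> 0"
  obtains u where "u 0 = x0"
    and "\<And>t. t \<in> {0..T} \<Longrightarrow> (u has_vector_derivative F (u t)) (at t within {0..T})"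
proof -
  define \<kappa> where "\<kappa> = L + 1"
  have L: "L \<ge> 0" using lip by (rule lipschitz_on_nonneg)
  then have \<kappa>: "\<kappa> > 0" by (simp add: \<kappa>_def)
  have contF: "continuous_on X F" for X
    using lipschitz_on_continuous_on[OF lip] continuous_on_subset by blast
  \<comment> \<open>The fixed point is sought among bounded continuous functions on the whole line; clipping
     the time to \<open>[0, T]\<close> extends functions on the interval to such functions.\<close>
  define clip where "clip t = max 0 (min T t)" for t
  have clip: "clip t \<in> {0..T}" for t using T by (auto simp: clip_def)
  have clip_id: "clip t = t" if "t \<in> {0..T}" for t using that by (auto simp: clip_def)
  have cont_clip: "continuous_on UNIV clip"
    unfolding clip_def by (intro continuous_intros)
  define g where "g v s = F (exp (\<kappa> * s) *\<^sub>R apply_bcontfun v s)" for v :: "real \<Rightarrow>\<^sub>C 'b" and s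
  have contg: "continuous_on X (g v)" for X v
    unfolding g_def by (intro continuous_on_compose2[OF contF[of UNIV]] continuous_intros) auto
  define h where "h v t = exp (- (\<kappa> * t)) *\<^sub>R (x0 + integral {0..t} (g v))" for v t
  have conth: "continuous_on {0..T} (h v)" for v
    unfolding h_def
    by (intro continuous_intros indefinite_integral_continuous_1 integrable_continuous_interval contg)
  have cont_h_clip: "(\<lambda>t. h v (clip t)) \<in> bcontfun" for v
  proof -
    have "continuous_on UNIV (\<lambda>t. h v (clip t))"
      by (rule continuous_on_compose2[OF conth cont_clip]) (use clip in auto)
    moreover have "range (\<lambda>t. h v (clip t)) \<subseteq> h v ` {0..T}" using clip by auto
    then have "bounded (range (\<lambda>t. h v (clip t)))"
      using compact_imp_bounded[OF compact_continuous_image[OF conth compact_Icc]] bounded_subset by blast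
    ultimately show ?thesis by (simp add: bcontfun_def)
  qed
  define K where "K v = Bcontfun (\<lambda>t. h v (clip t))" for v
  have K: "apply_bcontfun (K v) t = h v (clip t)" for v t
    by (simp add: K_def Bcontfun_inverse cont_h_clip)
  have contr: "dist (K v) (K w) \<le> (L / \<kappa>) * dist v w" for v w
  proof (rule dist_bound)
    fix t
    define r where "r = clip t"
    have r: "0 \<le> r" using clip[of t] by (simp add: r_def)
    have int: "g z integrable_on {0..r}" for z
      by (intro integrable_continuous_interval contg)
    have bd: "((\<lambda>s. L * dist v w * exp (\<kappa> * s)) has_integral
         L * dist v w / \<kappa> * exp (\<kappa> * r) - L * dist v w / \<kappa> * exp (\<kappa> * 0)) {0..r}"
      using r \<kappa> by (intro fundamental_theorem_of_calculus)
        (auto intro!: derivative_eq_intros simp flip: has_real_derivative_iff_has_vector_derivative)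
    have "norm (g v s - g w s) \<le> L * dist v w * exp (\<kappa> * s)" for s
    proof -
      have "norm (g v s - g w s) \<le> L * norm (exp (\<kappa> * s) *\<^sub>R v s - exp (\<kappa> * s) *\<^sub>R w s)"
        unfolding g_def by (rule lipschitz_on_normD[OF lip]) auto
      also have "\<dots> = L * (exp (\<kappa> * s) * dist (v s) (w s))"
        by (simp add: dist_norm flip: scaleR_right_diff_distrib)
      also have "\<dots> \<le> L * (exp (\<kappa> * s) * dist v w)"
        by (intro mult_left_mono dist_bounded L) auto
      finally show ?thesis by (simp add: mult_ac)
    qed
    then have "norm (integral {0..r} (\<lambda>s. g v s - g w s))
               \<le> integral {0..r} (\<lambda>s. L * dist v w * exp (\<kappa> * s))"
      using bd int by (intro integral_norm_bound_integral integrable_diff)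
        (auto simp: has_integral_integrable)
    also have "\<dots> = L * dist v w / \<kappa> * (exp (\<kappa> * r) - 1)"
      by (simp only: integral_unique[OF bd]) (simp add: right_diff_distrib)
    also have "\<dots> \<le> L * dist v w / \<kappa> * exp (\<kappa> * r)"
      using L \<kappa> by (intro mult_left_mono) auto
    finally have le: "norm (integral {0..r} (g v) - integral {0..r} (g w))
        \<le> L * dist v w / \<kappa> * exp (\<kappa> * r)"
      using int by (simp add: integral_diff)
    have "dist (K v t) (K w t)
        = exp (- (\<kappa> * r)) * norm (integral {0..r} (g v) - integral {0..r} (g w))"
      by (simp add: K h_def r_def dist_norm flip: scaleR_right_diff_distrib)
    also have "\<dots> \<le> exp (- (\<kappa> * r)) * (L * dist v w / \<kappa> * exp (\<kappa> * r))"
      by (intro mult_left_mono le) auto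
    also have "\<dots> = (L / \<kappa>) * dist v w"
      by (simp add: exp_minus field_simps)
    finally show "dist (K v t) (K w t) \<le> (L / \<kappa>) * dist v w" .
  qed
  have "\<exists>!v. K v = v"
    using L \<kappa> contr by (intro banach_fix_type[of "L / \<kappa>"]) (auto simp: \<kappa>_def)
  then obtain v where v: "K v = v" by blast
  define u where "u t = x0 + integral {0..t} (g v)" for t
  have gv: "g v t = F (u t)" if "t \<in> {0..T}" for t
  proof -
    have "v t = exp (- (\<kappa> * t)) *\<^sub>R u t"
      using K[of v t] clip_id[OF that] by (simp add: v h_def u_def)
    then show ?thesis by (simp add: g_def flip: exp_add)
  qed
  show thesis
  proof
    show "u 0 = x0" by (simp add: u_def)
    show "(u has_vector_derivative F (u t)) (at t within {0..T})" if t: "t \<in> {0..T}" for t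
    proof -
      have "((\<lambda>r. x0 + integral {0..r} (g v)) has_vector_derivative 0 + g v t) (at t within {0..T})"
        by (intro has_vector_derivative_add has_vector_derivative_const
            integral_has_vector_derivative contg t)
      then show ?thesis by (simp add: gv[OF t] u_def[abs_def])
    qed
  qed
qed

instance bcontfun :: (metric_space, banach) banach ..

text \<open>
  Vectors of variable length carry no metric of their own, so the Lipschitz condition is stated
  with the \<open>l\<^sup>1\<close> distance written out.
\<close>
definition l1_lipschitz :: "nat \<Rightarrow> (real vec \<Rightarrow> real) \<Rightarrow> bool" where
  "l1_lipschitz n f \<longleftrightarrow> (\<exists>L\<ge>0. \<forall>x\<in>carrier_vec n. \<forall>y\<in>carrier_vec n.
     \<bar>f x - f y\<bar> \<le> L * (\<Sum>k<n. \<bar>x $ k - y $ k\<bar>))"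

text \<open>
  The length \<open>n\<close> is a term, whereas the Picard-Lindeloef theorem above wants a Banach space as a
  type. The bounded real sequences, that is the bounded continuous functions on the discrete
  natural numbers, form one into which vectors of every length embed by padding with zeros.
\<close>
lemma ode_solution_exists:
  assumes lip: "\<And>i. i < n \<Longrightarrow> l1_lipschitz n (\<lambda>x. F x $ i)"
    and "T \<ge> 0" and x0: "x0 \<in> carrier_vec n"
  obtains u where "solves_ode_on n F T u" and "u 0 = x0"
proof -
  have "\<forall>i. \<exists>L. i < n \<longrightarrow> L \<ge> 0 \<and> (\<forall>x\<in>carrier_vec n. \<forall>y\<in>carrier_vec n.
      \<bar>F x $ i - F y $ i\<bar> \<le> L * (\<Sum>k<n. \<bar>x $ k - y $ k\<bar>))"
    using lip unfolding l1_lipschitz_def by blast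
  then obtain l where l0: "\<And>i. i < n \<Longrightarrow> l i \<ge> 0"
    and l: "\<And>i x y. i < n \<Longrightarrow> x \<in> carrier_vec n \<Longrightarrow> y \<in> carrier_vec n \<Longrightarrow>
      \<bar>F x $ i - F y $ i\<bar> \<le> l i * (\<Sum>k<n. \<bar>x $ k - y $ k\<bar>)"
    by metis
  define L where "L = (\<Sum>i<n. l i)"
  have L: "L \<ge> 0" unfolding L_def by (intro sum_nonneg l0) auto
  have lip: "\<bar>F x $ i - F y $ i\<bar> \<le> L * (\<Sum>k<n. \<bar>x $ k - y $ k\<bar>)"
    if "i < n" "x \<in> carrier_vec n" "y \<in> carrier_vec n" for i x y
  proof -
    have "l i \<le> L" unfolding L_def using that(1) l0 by (intro member_le_sum) auto
    then have "l i * (\<Sum>k<n. \<bar>x $ k - y $ k\<bar>) \<le> L * (\<Sum>k<n. \<bar>x $ k - y $ k\<bar>)"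
      by (intro mult_right_mono sum_nonneg) auto
    with l[OF that] show ?thesis by linarith
  qed
  define coord where "coord x k = apply_bcontfun x (discrete k)" for x :: "nat discrete \<Rightarrow>\<^sub>C real" and k
  have extend: "(\<lambda>d. if of_discrete d < n then f (of_discrete d) else 0) \<in> bcontfun"
    for f :: "nat \<Rightarrow> real"
  proof (rule bcontfun_normI)
    show "continuous_on UNIV (\<lambda>d. if of_discrete d < n then f (of_discrete d) else 0)"
      by (simp add: continuous_on_open_vimage open_discrete)
    show "norm (if of_discrete d < n then f (of_discrete d) else 0) \<le> (\<Sum>k<n. \<bar>f k\<bar>)" for d
      by (auto intro!: member_le_sum sum_nonneg)
  qed
  define e where "e f = Bcontfun (\<lambda>d. if of_discrete d < n then f (of_discrete d) else 0 :: real)"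
    for f :: "nat \<Rightarrow> real"
  have e: "apply_bcontfun (e f) d = (if of_discrete d < n then f (of_discrete d) else 0)" for f d
    by (simp add: e_def Bcontfun_inverse extend)
  define G where "G x = e (\<lambda>i. F (vec n (coord x)) $ i)" for x
  have "(L * n)-lipschitz_on UNIV G"
  proof (rule lipschitz_onI)
    fix x y
    show "dist (G x) (G y) \<le> L * n * dist x y"
    proof (rule dist_bound)
      fix d
      have "\<bar>F (vec n (coord x)) $ i - F (vec n (coord y)) $ i\<bar> \<le> L * n * dist x y" if "i < n" for i
      proof -
        have "\<bar>F (vec n (coord x)) $ i - F (vec n (coord y)) $ i\<bar>
            \<le> L * (\<Sum>k<n. \<bar>vec n (coord x) $ k - vec n (coord y) $ k\<bar>)"
          using that by (intro lip) auto
        also have "\<dots> \<le> L * (\<Sum>k<n. dist x y)"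
          using dist_bounded[of x _ y]
          by (intro mult_left_mono sum_mono L) (auto simp: coord_def dist_real_def)
        finally show ?thesis by simp
      qed
      then show "dist (apply_bcontfun (G x) d) (apply_bcontfun (G y) d) \<le> L * n * dist x y"
        using L by (auto simp: G_def e dist_real_def)
    qed
  qed (use L in simp)
  from picard_lindelof_lipschitz[OF this assms(2)]
  obtain w where w0: "w 0 = e (\<lambda>i. x0 $ i)"
    and w: "\<And>t. t \<in> {0..T} \<Longrightarrow> (w has_vector_derivative G (w t)) (at t within {0..T})"
    by metis
  have lin: "bounded_linear (\<lambda>x. coord x i)" for i
  proof
    show "\<exists>K. \<forall>x. norm (coord x i) \<le> norm x * K"
      by (rule exI[of _ 1]) (simp add: coord_def norm_bounded del: real_norm_def)
  qed (auto simp: coord_def)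
  define u where "u t = vec n (coord (w t))" for t
  show thesis
  proof
    show "u 0 = x0" using x0 by (auto simp: u_def w0 e coord_def discrete_inverse)
    have "((\<lambda>s. u s $ i) has_real_derivative F (u t) $ i) (at t within {0..T})"
      if "t \<in> {0..T}" "i < n" for t i
    proof -
      have "coord (G (w t)) i = F (u t) $ i"
        using that(2) by (simp add: G_def e coord_def[of "e _"] discrete_inverse u_def)
      then show ?thesis
        using bounded_linear.has_vector_derivative[OF lin w[OF that(1)], of i] that(2)
        by (simp add: has_real_derivative_iff_has_vector_derivative u_def)
    qed
    then show "solves_ode_on n F T u"
      by (auto simp: solves_ode_on_def u_def)
  qed
qed

section \<open>A calculus of Lipschitz functions\<close>

lemma l1_lipschitz_const: "l1_lipschitz n (\<lambda>x. C)"
  unfolding l1_lipschitz_def by (rule exI[of _ 0]) auto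

lemma l1_lipschitz_coordinate: "k < n \<Longrightarrow> l1_lipschitz n (\<lambda>x. x $ k)"
  unfolding l1_lipschitz_def
  by (rule exI[of _ 1]) (auto intro!: member_le_sum[where f = "\<lambda>k. \<bar>_ $ k - _ $ k\<bar>"])

lemma l1_lipschitz_add:
  assumes "l1_lipschitz n f" and "l1_lipschitz n g"
  shows "l1_lipschitz n (\<lambda>x. f x + g x)"
proof -
  obtain K where "K \<ge> 0" and K: "\<And>x y. x \<in> carrier_vec n \<Longrightarrow> y \<in> carrier_vec n \<Longrightarrow>
      \<bar>f x - f y\<bar> \<le> K * (\<Sum>k<n. \<bar>x $ k - y $ k\<bar>)"
    using assms(1) unfolding l1_lipschitz_def by blast
  moreover obtain L where "L \<ge> 0" and L: "\<And>x y. x \<in> carrier_vec n \<Longrightarrow> y \<in> carrier_vec n \<Longrightarrow>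
      \<bar>g x - g y\<bar> \<le> L * (\<Sum>k<n. \<bar>x $ k - y $ k\<bar>)"
    using assms(2) unfolding l1_lipschitz_def by blast
  moreover have "\<bar>f x + g x - (f y + g y)\<bar> \<le> (K + L) * (\<Sum>k<n. \<bar>x $ k - y $ k\<bar>)"
    if "x \<in> carrier_vec n" "y \<in> carrier_vec n" for x y
    unfolding distrib_right using K[OF that] L[OF that] by linarith
  ultimately show ?thesis
    unfolding l1_lipschitz_def by (intro exI[of _ "K + L"]) auto
qed

lemma l1_lipschitz_mult_bounded:
  assumes "l1_lipschitz n f" and "l1_lipschitz n g"
    and f: "\<And>x. x \<in> carrier_vec n \<Longrightarrow> \<bar>f x\<bar> \<le> A"
    and g: "\<And>x. x \<in> carrier_vec n \<Longrightarrow> \<bar>g x\<bar> \<le> B"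
  shows "l1_lipschitz n (\<lambda>x. f x * g x)"
proof -
  obtain K where K0: "K \<ge> 0" and K: "\<And>x y. x \<in> carrier_vec n \<Longrightarrow> y \<in> carrier_vec n \<Longrightarrow>
      \<bar>f x - f y\<bar> \<le> K * (\<Sum>k<n. \<bar>x $ k - y $ k\<bar>)"
    using assms(1) unfolding l1_lipschitz_def by blast
  obtain L where L0: "L \<ge> 0" and L: "\<And>x y. x \<in> carrier_vec n \<Longrightarrow> y \<in> carrier_vec n \<Longrightarrow>
      \<bar>g x - g y\<bar> \<le> L * (\<Sum>k<n. \<bar>x $ k - y $ k\<bar>)"
    using assms(2) unfolding l1_lipschitz_def by blast
  have AB: "A \<ge> 0" "B \<ge> 0"
    using f[of "0\<^sub>v n"] g[of "0\<^sub>v n"] by auto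
  have "\<bar>f x * g x - f y * g y\<bar> \<le> (A * L + B * K) * (\<Sum>k<n. \<bar>x $ k - y $ k\<bar>)"
    if xy: "x \<in> carrier_vec n" "y \<in> carrier_vec n" for x y
  proof -
    let ?d = "\<Sum>k<n. \<bar>x $ k - y $ k\<bar>"
    have "f x * g x - f y * g y = f x * (g x - g y) + g y * (f x - f y)"
      by (simp add: algebra_simps)
    also have "\<bar>\<dots>\<bar> \<le> \<bar>f x\<bar> * \<bar>g x - g y\<bar> + \<bar>g y\<bar> * \<bar>f x - f y\<bar>"
      using abs_triangle_ineq by (simp flip: abs_mult)
    also have "\<dots> \<le> A * (L * ?d) + B * (K * ?d)"
      using K[OF xy] L[OF xy] f[OF xy(1)] g[OF xy(2)] AB by (intro add_mono mult_mono) auto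
    finally show ?thesis by (simp add: algebra_simps)
  qed
  then show ?thesis
    using K0 L0 AB unfolding l1_lipschitz_def by (intro exI[of _ "A * L + B * K"]) auto
qed

lemma l1_lipschitz_compose:
  assumes "l1_lipschitz n f" and h: "K-lipschitz_on S h"
    and S: "\<And>x. x \<in> carrier_vec n \<Longrightarrow> f x \<in> S"
  shows "l1_lipschitz n (\<lambda>x. h (f x))"
proof -
  obtain L where L0: "L \<ge> 0" and L: "\<And>x y. x \<in> carrier_vec n \<Longrightarrow> y \<in> carrier_vec n \<Longrightarrow>
      \<bar>f x - f y\<bar> \<le> L * (\<Sum>k<n. \<bar>x $ k - y $ k\<bar>)"
    using assms(1) unfolding l1_lipschitz_def by blast
  have K0: "K \<ge> 0" using h by (rule lipschitz_on_nonneg)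
  have "\<bar>h (f x) - h (f y)\<bar> \<le> K * L * (\<Sum>k<n. \<bar>x $ k - y $ k\<bar>)"
    if xy: "x \<in> carrier_vec n" "y \<in> carrier_vec n" for x y
  proof -
    have "\<bar>h (f x) - h (f y)\<bar> \<le> K * \<bar>f x - f y\<bar>"
      using lipschitz_onD[OF h S[OF xy(1)] S[OF xy(2)]] by (simp add: dist_real_def)
    also have "\<dots> \<le> K * (L * (\<Sum>k<n. \<bar>x $ k - y $ k\<bar>))"
      by (intro mult_left_mono L xy K0)
    finally show ?thesis by (simp add: mult.assoc)
  qed
  then show ?thesis
    using K0 L0 unfolding l1_lipschitz_def by (intro exI[of _ "K * L"]) auto
qed

lemma l1_lipschitz_cmult: "l1_lipschitz n f \<Longrightarrow> l1_lipschitz n (\<lambda>x. C * f x)"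
  by (rule l1_lipschitz_compose[of n f "\<bar>C\<bar>" UNIV])
    (auto intro: lipschitz_on_cmult_real[OF lipschitz_on_id, of C, simplified])

lemma l1_lipschitz_sum:
  "(\<And>j. j \<in> S \<Longrightarrow> l1_lipschitz n (f j)) \<Longrightarrow> l1_lipschitz n (\<lambda>x. \<Sum>j\<in>S. f j x)"
  by (induction S rule: infinite_finite_induct) (auto intro: l1_lipschitz_const l1_lipschitz_add)

lemma l1_lipschitz_sin:
  assumes "l1_lipschitz n f" shows "l1_lipschitz n (\<lambda>x. sin (f x))"
proof (rule l1_lipschitz_compose[OF assms])
  show "1-lipschitz_on UNIV (sin :: real \<Rightarrow> real)"
    by (rule bounded_derivative_imp_lipschitz[where f' = "\<lambda>x. (*) (cos x)"])
      (auto intro!: derivative_eq_intros onorm_le simp: mult_left_le_one_le abs_mult)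
qed auto

lemma l1_lipschitz_cos:
  assumes "l1_lipschitz n f" shows "l1_lipschitz n (\<lambda>x. cos (f x))"
  using l1_lipschitz_sin[OF l1_lipschitz_add[OF assms l1_lipschitz_const[of n "pi / 2"]]]
  by (simp add: sin_add)

text \<open>
  The square root is Lipschitz away from zero only, hence the lower bound \<open>C\<close>.
\<close>
lemma l1_lipschitz_sqrt:
  assumes "l1_lipschitz n f" and "C > 0" and "\<And>x. x \<in> carrier_vec n \<Longrightarrow> C \<le> f x"
  shows "l1_lipschitz n (\<lambda>x. sqrt (f x))"
proof (rule l1_lipschitz_compose[OF assms(1), where S = "{C..}"])
  show "(1 / sqrt C)-lipschitz_on {C..} sqrt"
  proof (rule lipschitz_onI)
    fix x y assume xy: "x \<in> {C..}" "y \<in> {C..}"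
    then have pos: "sqrt C > 0" "sqrt C \<le> sqrt x" "sqrt y > 0"
      using assms(2) by auto
    have "x - y = (sqrt x - sqrt y) * (sqrt x + sqrt y)"
      using xy assms(2) by (simp add: algebra_simps)
    then have "\<bar>x - y\<bar> = \<bar>sqrt x - sqrt y\<bar> * (sqrt x + sqrt y)"
      using pos by (simp add: abs_mult)
    also have "\<dots> \<ge> \<bar>sqrt x - sqrt y\<bar> * sqrt C"
      using pos by (intro mult_left_mono) linarith+
    finally show "dist (sqrt x) (sqrt y) \<le> 1 / sqrt C * dist x y"
      using pos by (simp add: dist_real_def field_simps)
  qed (use assms(2) in auto)
qed (use assms(3) in auto)

section \<open>Instability along an expanding coordinate\<close>

lemma half_square_le_mult_sin:
  assumes "\<bar>w\<bar> \<le> (1::real)" shows "w\<^sup>2 / 2 \<le> w * sin w"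
proof -
  have "\<bar>sin w - w\<bar> \<le> \<bar>w\<bar> ^ 3 / 6"
    using Maclaurin_sin_bound[of w 3]
    by (simp add: eval_nat_numeral sin_coeff_def divide_simps)
  then have "\<bar>w\<bar> * \<bar>sin w - w\<bar> \<le> \<bar>w\<bar> * (\<bar>w\<bar> ^ 3 / 6)"
    by (intro mult_left_mono) auto
  also have "\<dots> = w\<^sup>2 * w\<^sup>2 / 6"
    by (simp add: power2_eq_square power3_eq_cube flip: abs_mult)
  also have "\<dots> \<le> w\<^sup>2 * 1 / 6"
    using assms by (intro divide_right_mono mult_left_mono) (auto simp: abs_square_le_1)
  finally have "\<bar>w * sin w - w\<^sup>2\<bar> \<le> w\<^sup>2 / 6"
    by (simp add: power2_eq_square right_diff_distrib flip: abs_mult)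
  moreover have "w\<^sup>2 \<ge> 0" by simp
  ultimately show ?thesis by linarith
qed

text \<open>
  Start at distance \<open>\<eta>\<close> from \<open>p\<close> in the direction of coordinate \<open>i\<close>. The displacement \<open>w\<close> of
  that coordinate obeys \<open>w' = \<rho> sin w\<close>, so \<open>(w\<^sup>2)' = 2\<rho> w sin w \<ge> \<rho> w\<^sup>2\<close> while \<open>\<bar>w\<bar> \<le> 1\<close>, and
  \<open>w\<^sup>2 e\<^sup>-\<^sup>\<rho>\<^sup>t\<close> does not decrease. Hence \<open>w\<close> leaves the unit ball in finite time, however small \<open>\<eta>\<close>
  is.
\<close>
lemma not_lyapunov_stable_if_expanding_coordinate:
  assumes p: "p \<in> carrier_vec n" and i: "i < n" and \<rho>: "\<rho> > 0"
    and lip: "\<And>k. k < n \<Longrightarrow> l1_lipschitz n (\<lambda>x. F x $ k)"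
    and rest: "\<And>x k. x \<in> carrier_vec n \<Longrightarrow> (\<forall>l<i. x $ l = p $ l) \<Longrightarrow> k < i \<Longrightarrow> F x $ k = 0"
    and expand: "\<And>x. x \<in> carrier_vec n \<Longrightarrow> (\<forall>l<i. x $ l = p $ l) \<Longrightarrow>
      F x $ i = \<rho> * sin (x $ i - p $ i)"
  shows "\<not> lyapunov_stable n F p"
proof
  assume "lyapunov_stable n F p"
  then have "\<exists>\<delta>>0. \<forall>T\<ge>0. \<forall>u. solves_ode_on n F T u \<and> vdist n (u 0) p < \<delta> \<longrightarrow>
      (\<forall>t\<in>{0..T}. vdist n (u t) p < 1)"
    unfolding lyapunov_stable_def by (elim allE[of _ "1 :: real"]) simp
  then obtain \<delta> where \<delta>: "\<delta> > 0" and stable: "\<forall>T\<ge>0. \<forall>u. solves_ode_on n F T u \<and>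
      vdist n (u 0) p < \<delta> \<longrightarrow> (\<forall>t\<in>{0..T}. vdist n (u t) p < 1)"
    by blast
  define \<eta> where "\<eta> = \<delta> / 2"
  have \<eta>: "\<eta> > 0" using \<delta> by (simp add: \<eta>_def)
  \<comment> \<open>This time suffices because \<open>\<eta>\<^sup>2 e\<^sup>\<rho>\<^sup>T \<ge> \<eta>\<^sup>2 (1 + \<rho>T) = \<eta>\<^sup>2 + 1 > 1\<close>.\<close>
  define T where "T = 1 / (\<rho> * \<eta>\<^sup>2)"
  have T: "T > 0" using \<rho> \<eta> by (simp add: T_def)
  define x0 where "x0 = p + \<eta> \<cdot>\<^sub>v unit_vec n i"
  \<comment> \<open>Solutions of \<open>F\<close> with resting earlier coordinates are obtained from the field in which these
     coordinates are frozen by force: along a solution \<open>u\<close> of the latter, \<open>F (u t) = G (u t)\<close>.\<close>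
  define G where "G x = vec n (\<lambda>k. if k < i then 0 else F x $ k)" for x
  have x0: "x0 \<in> carrier_vec n" using p by (simp add: x0_def)
  have "l1_lipschitz n (\<lambda>x. G x $ k)" if "k < n" for k
    using lip[OF that] that by (cases "k < i") (simp_all add: G_def l1_lipschitz_const)
  then obtain u where u: "solves_ode_on n G T u" and u0: "u 0 = x0"
    using T x0 by (metis less_imp_le ode_solution_exists)
  have carrier: "u t \<in> carrier_vec n" if "t \<in> {0..T}" for t
    using u that by (simp add: solves_ode_on_def)
  have deriv: "((\<lambda>s. u s $ k) has_real_derivative G (u t) $ k) (at t within {0..T})"
    if "t \<in> {0..T}" "k < n" for t k
    using u that by (simp add: solves_ode_on_def)
  have frozen: "u t $ k = p $ k" if t: "t \<in> {0..T}" and k: "k < i" for t k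
  proof -
    have "\<exists>c. \<forall>s\<in>{0..T}. u s $ k = c"
      using deriv[of _ k] k i
      by (intro has_field_derivative_zero_constant) (auto simp: G_def)
    then have "u t $ k = u 0 $ k" using t T by force
    then show ?thesis using k i p by (simp add: u0 x0_def)
  qed
  have "G (u t) $ k = F (u t) $ k" if "t \<in> {0..T}" "k < n" for t k
    using rest[OF carrier[OF that(1)], of k] frozen[OF that(1)] that(2) by (auto simp: G_def)
  then have sol: "solves_ode_on n F T u"
    using u by (simp add: solves_ode_on_def)
  have "vdist n (u 0) p = \<eta>"
  proof -
    have "vdist n (u 0) p = L2_set (\<lambda>k. if k = i then \<eta> else 0) {..<n}"
      unfolding vdist_def using p i by (intro L2_set_cong) (auto simp: u0 x0_def)
    also have "\<dots> = sqrt (\<Sum>k<n. if k = i then \<eta>\<^sup>2 else 0)"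
      unfolding L2_set_def by (intro arg_cong[where f = sqrt] sum.cong) auto
    also have "\<dots> = \<eta>" using i \<eta> by simp
    finally show ?thesis .
  qed
  then have "vdist n (u 0) p < \<delta>" using \<delta> by (simp add: \<eta>_def)
  then have near: "vdist n (u t) p < 1" if "t \<in> {0..T}" for t
    using stable sol that less_imp_le[OF T] by blast
  define w where "w t = u t $ i - p $ i" for t
  have w_le: "\<bar>w t\<bar> \<le> 1" if "t \<in> {0..T}" for t
  proof -
    have "\<bar>w t\<bar> \<le> L2_set (\<lambda>k. \<bar>u t $ k - p $ k\<bar>) {..<n}"
      unfolding w_def using i by (intro member_le_L2_set) auto
    also have "\<dots> = vdist n (u t) p" by (simp add: vdist_def L2_set_def)
    finally show ?thesis using near[OF that] by simp
  qed
  have dw: "(w has_real_derivative \<rho> * sin (w t)) (at t within {0..T})" if t: "t \<in> {0..T}" for t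
  proof -
    have "G (u t) $ i = \<rho> * sin (w t)"
      using expand[OF carrier[OF t]] frozen[OF t] i by (simp add: G_def w_def)
    with deriv[OF t i] show ?thesis
      unfolding w_def[abs_def] by (auto intro!: derivative_eq_intros)
  qed
  define h where "h t = (w t)\<^sup>2 * exp (- (\<rho> * t))" for t
  have "h 0 \<le> h T"
  proof (rule DERIV_nonneg_imp_increasing_open[of 0 T h])
    have dh: "(h has_real_derivative
        \<rho> * exp (- (\<rho> * t)) * (2 * (w t * sin (w t)) - (w t)\<^sup>2)) (at t within {0..T})"
      if "t \<in> {0..T}" for t
      unfolding h_def[abs_def]
      by (rule derivative_eq_intros dw[OF that] refl)+ (simp add: algebra_simps)
    show "continuous_on {0..T} h"
      using dh by (intro DERIV_continuous_on) auto
    show "\<exists>y. (h has_real_derivative y) (at t) \<and> y \<ge> 0" if t: "0 < t" "t < T" for t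
    proof (intro exI conjI)
      show "(h has_real_derivative
          \<rho> * exp (- (\<rho> * t)) * (2 * (w t * sin (w t)) - (w t)\<^sup>2)) (at t)"
        using dh[of t] t by (simp add: at_within_Icc_at)
      show "\<rho> * exp (- (\<rho> * t)) * (2 * (w t * sin (w t)) - (w t)\<^sup>2) \<ge> 0"
        using half_square_le_mult_sin[OF w_le, of t] t \<rho> by (intro mult_nonneg_nonneg) auto
    qed
  qed (use T in simp)
  also have "h T \<le> 1 * exp (- (\<rho> * T))"
    unfolding h_def using w_le[of T] T by (intro mult_right_mono) (auto simp: abs_square_le_1)
  finally have "\<eta>\<^sup>2 * exp (\<rho> * T) \<le> 1"
    using p i by (simp add: h_def w_def u0 x0_def exp_minus field_simps)
  moreover have "\<eta>\<^sup>2 * exp (\<rho> * T) \<ge> \<eta>\<^sup>2 * (1 + \<rho> * T)"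
    by (intro mult_left_mono) auto
  moreover have "\<eta>\<^sup>2 * (1 + \<rho> * T) = \<eta>\<^sup>2 + 1"
    using \<rho> \<eta> by (simp add: T_def field_simps)
  moreover have "\<eta>\<^sup>2 > 0" using \<eta> by simp
  ultimately show False by linarith
qed

section \<open>Eigenvalues of triangular matrices\<close>

lemma complex_eigenvalues_lower_triangular:
  assumes A: "A \<in> carrier_mat n n" and lower: "\<And>i j. i < j \<Longrightarrow> j < n \<Longrightarrow> A $$ (i, j) = 0"
  shows "complex_eigenvalues A = (\<lambda>i. complex_of_real (A $$ (i, i))) ` {..<n}"
proof -
  define B where "B = transpose_mat (map_mat complex_of_real A)"
  have C: "map_mat complex_of_real A \<in> carrier_mat n n" and B: "B \<in> carrier_mat n n"
    using A by (auto simp: B_def)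
  have "upper_triangular B"
    using A lower by (auto simp: B_def upper_triangular_def)
  then have "char_poly B = (\<Prod>a\<leftarrow>diag_mat B. [:- a, 1:])"
    using B by (intro char_poly_upper_triangular)
  moreover have "char_poly B = char_poly (map_mat complex_of_real A)"
    unfolding B_def by (rule char_poly_transpose_mat[OF C])
  ultimately have "eigenvalue (map_mat complex_of_real A) z \<longleftrightarrow> z \<in> set (diag_mat B)" for z
    by (auto simp: eigenvalue_root_char_poly[OF C] poly_prod_list)
  then show ?thesis
    using A by (auto simp: complex_eigenvalues_def diag_mat_def B_def)
qed

section \<open>The angles \<open>\<theta>\<^sub>i\<close> at multiples of \<open>\<pi>\<close>\<close>

lemma theta_line:
  assumes "p \<in> carrier_vec n" and "v \<in> carrier_vec n" and "i < n"
  shows "theta (p + s \<cdot>\<^sub>v v) i = theta p i + s * theta v i"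
proof -
  have "(\<Sum>j=1..<i. (-1) ^ (j + 1) * (p + s \<cdot>\<^sub>v v) $ j)
      = (\<Sum>j=1..<i. (-1) ^ (j + 1) * p $ j) + s * (\<Sum>j=1..<i. (-1) ^ (j + 1) * v $ j)"
    unfolding sum_distrib_left sum.distrib[symmetric]
    using assms by (intro sum.cong refl) (auto simp: algebra_simps)
  then show ?thesis
    using assms by (simp add: theta_def algebra_simps)
qed

lemma theta_unit_vec_self:
  assumes "1 \<le> i" "i < n" shows "theta (unit_vec n i) i = (-1) ^ (i + 1)"
proof -
  have "(\<Sum>j=1..<i. (-1) ^ (j + 1) * unit_vec n i $ j) = (0::real)"
    using assms by (intro sum.neutral) auto
  then show ?thesis using assms by (simp add: theta_def)
qed

lemma theta_unit_vec_later:
  assumes "1 \<le> i" "i < j" "j < n" shows "theta (unit_vec n j) i = 0"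
proof -
  have "(\<Sum>k=1..<i. (-1) ^ (k + 1) * unit_vec n j $ k) = (0::real)"
    using assms by (intro sum.neutral) auto
  then show ?thesis using assms by (simp add: theta_def)
qed

text \<open>
  The earlier angles enter \<open>\<theta>\<^sub>i\<close> with the factor 2, so multiples of \<open>\<pi>\<close> among them are invisible
  modulo \<open>2\<pi>\<close>.
\<close>
lemma theta_cong_coordinate:
  assumes "\<And>j. 1 \<le> j \<Longrightarrow> j < i \<Longrightarrow> sin (p $ j) = 0"
  obtains k :: int where "theta p i = (-1) ^ (i + 1) * p $ i + 2 * pi * k"
proof -
  have "\<forall>j. \<exists>k::int. 1 \<le> j \<and> j < i \<longrightarrow> p $ j = of_int k * pi"
    using assms sin_zero_iff_int2 by blast
  then obtain k :: "nat \<Rightarrow> int" where k: "\<And>j. 1 \<le> j \<Longrightarrow> j < i \<Longrightarrow> p $ j = of_int (k j) * pi"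
    by metis
  define K :: int where "K = (\<Sum>j=1..<i. (-1) ^ (j + 1) * k j)"
  have "(\<Sum>j=1..<i. (-1) ^ (j + 1) * p $ j) = (\<Sum>j=1..<i. pi * of_int ((-1) ^ (j + 1) * k j))"
    by (intro sum.cong refl) (simp add: k)
  also have "\<dots> = pi * K"
    by (simp only: K_def of_int_sum sum_distrib_left)
  finally have "theta p i = (-1) ^ (i + 1) * p $ i + 2 * pi * K"
    by (simp add: theta_def)
  then show thesis by (rule that)
qed

lemma sin_theta_cos_theta:
  assumes "\<And>j. 1 \<le> j \<Longrightarrow> j < i \<Longrightarrow> sin (p $ j) = 0"
  shows "sin (theta p i) = (-1) ^ (i + 1) * sin (p $ i)" "cos (theta p i) = cos (p $ i)"
proof -
  obtain k :: int where k: "theta p i = (-1) ^ (i + 1) * p $ i + 2 * pi * k"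
    using theta_cong_coordinate assms by blast
  have "[theta p i = (-1) ^ (i + 1) * p $ i] (rmod (2 * pi))"
    using k by (auto simp: rcong_two_pi_iff)
  then have "sin (theta p i) = sin ((-1) ^ (i + 1) * p $ i)"
    "cos (theta p i) = cos ((-1) ^ (i + 1) * p $ i)"
    by (rule sin_rcong, rule cos_rcong)
  then show "sin (theta p i) = (-1) ^ (i + 1) * sin (p $ i)" "cos (theta p i) = cos (p $ i)"
    by (cases "even i"; simp)+
qed

lemma sin_theta_zero_iff:
  "(\<forall>i\<in>{1..N}. sin (theta p i) = 0) \<longleftrightarrow> (\<forall>i\<in>{1..N}. sin (p $ i) = 0)"
proof (induction N)
  case (Suc N)
  have "sin (theta p (Suc N)) = 0 \<longleftrightarrow> sin (p $ Suc N) = 0" if "\<forall>i\<in>{1..N}. sin (p $ i) = 0"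
    using that by (subst sin_theta_cos_theta) auto
  with Suc show ?case by (auto simp: atLeastAtMostSuc_conv)
qed simp

lemma cos_eq_1_iff_rcong: "cos x = 1 \<longleftrightarrow> [x = 0] (rmod (2 * pi))"
  by (simp only: cos_one_2pi_int rcong_two_pi_iff) (auto simp: mult_ac)

lemma cos_eq_minus_1_iff_rcong: "cos x = -1 \<longleftrightarrow> [x = pi] (rmod (2 * pi))"
proof -
  have "cos x = -1 \<longleftrightarrow> cos (x - pi) = 1" by (auto simp: cos_diff)
  also have "\<dots> \<longleftrightarrow> [x = pi] (rmod (2 * pi))"
    by (simp only: cos_one_2pi_int rcong_two_pi_iff) (auto simp: algebra_simps)
  finally show ?thesis .
qed

lemma sin_zero_iff_rcong: "sin x = 0 \<longleftrightarrow> [x = 0] (rmod (2 * pi)) \<or> [x = pi] (rmod (2 * pi))"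
  unfolding cos_eq_1_iff_rcong[symmetric] cos_eq_minus_1_iff_rcong[symmetric]
  by (simp add: cos_squared_eq flip: power2_eq_1_iff)

section \<open>The vector field of the vehicle\<close>

locale wheeled_vehicle =
  fixes N :: nat and m I a c :: "nat \<Rightarrow> real"
  assumes mass_pos: "i \<le> N \<Longrightarrow> m i > 0"
    and inertia_pos: "i \<le> N \<Longrightarrow> I i > 0"
    and a0_pos: "a 0 > 0"
    and c_pos: "1 \<le> i \<Longrightarrow> i \<le> N \<Longrightarrow> c i > 0"
begin

abbreviation field where "field \<equiv> vehicle_field N m I a c"
abbreviation \<Phi> where "\<Phi> \<equiv> Phi0 N m I a c"
abbreviation J where "J \<equiv> sleigh_J m I a"
abbreviation b where "b \<equiv> sleigh_b m a"

lemma J_pos: "J > 0"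
  using mass_pos[of 0] inertia_pos[of 0] unfolding sleigh_J_def
  by (intro add_pos_nonneg) auto

lemma b_pos: "b > 0"
  using mass_pos[of 0] a0_pos by (simp add: sleigh_b_def)

text \<open>
  Although \<open>\<mu>\<^sub>i\<close> may be negative, completing the square gives
  \<open>\<mu>\<^sub>i = (I\<^sub>i + m\<^sub>i (a\<^sub>i - c\<^sub>i)\<^sup>2) / c\<^sub>i\<^sup>2 - m\<^sub>i\<close>, so \<open>\<mu>\<^sub>i sin\<^sup>2 \<theta>\<^sub>i\<close> never outweighs the mass \<open>m\<^sub>i\<close> and
  at least \<open>m\<^sub>0\<close> remains.
\<close>
lemma Phi_ge: "m 0 \<le> \<Phi> x"
proof -
  have "0 \<le> m i + mu m I a c i * (sin (theta x i))\<^sup>2" if i: "i \<in> {1..N}" for i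
  proof -
    define s where "s = (sin (theta x i))\<^sup>2"
    have s: "0 \<le> s" "s \<le> 1" by (auto simp: s_def abs_square_le_1)
    have c: "c i > 0" using c_pos i by simp
    have "m i + mu m I a c i * s = m i * (1 - s) + (I i + m i * (a i - c i)\<^sup>2) / (c i)\<^sup>2 * s"
      using c by (simp add: mu_def field_simps power2_eq_square)
    also have "\<dots> \<ge> 0"
      using s mass_pos[of i] inertia_pos[of i] i
      by (intro add_nonneg_nonneg mult_nonneg_nonneg divide_nonneg_nonneg) (auto simp: less_imp_le)
    finally show ?thesis by (simp add: s_def)
  qed
  then have "0 \<le> (\<Sum>i=1..N. m i + mu m I a c i * (sin (theta x i))\<^sup>2)"
    by (rule sum_nonneg)
  moreover have "(\<Sum>i=0..N. m i) = m 0 + (\<Sum>i=1..N. m i)"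
    by (simp add: sum.atLeast_Suc_atMost)
  ultimately show ?thesis by (simp add: Phi0_def sum.distrib)
qed

lemma Phi_pos: "\<Phi> x > 0"
  using Phi_ge[of x] mass_pos[of 0] by linarith

lemma Phi_le: "\<Phi> x \<le> (\<Sum>i=0..N. m i) + (\<Sum>i=1..N. \<bar>mu m I a c i\<bar>)"
proof -
  have "mu m I a c i * (sin (theta x i))\<^sup>2 \<le> \<bar>mu m I a c i\<bar> * 1" for i
    using mult_mono[of "mu m I a c i" "\<bar>mu m I a c i\<bar>" "(sin (theta x i))\<^sup>2" 1]
    by (simp add: abs_square_le_1)
  then show ?thesis unfolding Phi0_def by (intro add_left_mono sum_mono) simp
qed

lemma field_0: "field x $ 0 = - (b / J) * sin (x $ 0)"
  by (simp add: vehicle_field_def)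

lemma field_nth: "1 \<le> i \<Longrightarrow> i \<le> N \<Longrightarrow> field x $ i =
    (-1) ^ i / c i * cos (x $ 0) * sin (theta x i) - sqrt (\<Phi> x) / sqrt J * sin (x $ 0)"
  by (simp add: vehicle_field_def)

lemma l1_lipschitz_theta: "i \<le> N \<Longrightarrow> l1_lipschitz (N + 1) (\<lambda>x. theta x i)"
  unfolding theta_def
  by (intro l1_lipschitz_add l1_lipschitz_cmult l1_lipschitz_sum l1_lipschitz_coordinate) auto

lemma l1_lipschitz_Phi: "l1_lipschitz (N + 1) \<Phi>"
proof -
  have "l1_lipschitz (N + 1) (\<lambda>x. (\<Sum>i=0..N. m i) +
      (\<Sum>i=1..N. mu m I a c i * (sin (theta x i) * sin (theta x i))))"
    by (intro l1_lipschitz_add l1_lipschitz_const l1_lipschitz_sum l1_lipschitz_cmult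
        l1_lipschitz_mult_bounded[where A = 1 and B = 1] l1_lipschitz_sin l1_lipschitz_theta) auto
  then show ?thesis by (simp add: Phi0_def[abs_def] power2_eq_square)
qed

text \<open>
  The lower bound on \<open>\<Phi>\<^sub>0\<close> makes its root Lipschitz, the upper bound makes the root bounded, so
  that its product with \<open>sin \<vartheta>\<close> is Lipschitz too.
\<close>
lemma l1_lipschitz_field:
  assumes "k < N + 1" shows "l1_lipschitz (N + 1) (\<lambda>x. field x $ k)"
proof (cases "k = 0")
  case True
  then show ?thesis
    using l1_lipschitz_cmult[OF l1_lipschitz_sin[OF l1_lipschitz_coordinate[of 0 "N + 1"]], of "- (b / J)"]
    by (simp add: field_0)
next
  case False
  have "l1_lipschitz (N + 1) (\<lambda>x. (-1) ^ k / c k * (cos (x $ 0) * sin (theta x k))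
      + (- 1 / sqrt J) * (sqrt (\<Phi> x) * sin (x $ 0)))"
  proof (intro l1_lipschitz_add l1_lipschitz_cmult)
    show "l1_lipschitz (N + 1) (\<lambda>x. cos (x $ 0) * sin (theta x k))"
      using assms by (intro l1_lipschitz_mult_bounded[where A = 1 and B = 1] l1_lipschitz_sin
          l1_lipschitz_cos l1_lipschitz_theta l1_lipschitz_coordinate) auto
    have "l1_lipschitz (N + 1) (\<lambda>x. sqrt (\<Phi> x))"
      by (rule l1_lipschitz_sqrt[OF l1_lipschitz_Phi mass_pos[of 0] Phi_ge]) simp
    then show "l1_lipschitz (N + 1) (\<lambda>x. sqrt (\<Phi> x) * sin (x $ 0))"
      using Phi_le Phi_pos
      by (intro l1_lipschitz_mult_bounded[where B = 1 and
            A = "sqrt ((\<Sum>i=0..N. m i) + (\<Sum>i=1..N. \<bar>mu m I a c i\<bar>))"] l1_lipschitz_sin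
          l1_lipschitz_coordinate) (auto simp: less_imp_le)
  qed
  then show ?thesis
    using False assms by (simp add: field_nth algebra_simps)
qed

subsection \<open>Fixed points\<close>

text \<open>
  At fixed points the angles \<open>\<theta>\<^sub>i\<close> can be traded for the coordinates themselves: this description
  is the product of \<open>N + 1\<close> copies of \<open>\<pi>\<int>\<close>, which makes counting immediate. Lemma
  \<open>fixed_points_field\<close> identifies it with the zeros of the field.
\<close>
definition fixed_point :: "real vec \<Rightarrow> bool" where
  "fixed_point p \<longleftrightarrow> p \<in> carrier_vec (N + 1) \<and> (\<forall>i\<le>N. sin (p $ i) = 0)"

lemma sin_theta_fixed: "fixed_point p \<Longrightarrow> i \<le> N \<Longrightarrow> sin (theta p i) = 0"
  and cos_theta_fixed: "fixed_point p \<Longrightarrow> i \<le> N \<Longrightarrow> cos (theta p i) = cos (p $ i)"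
  using sin_theta_cos_theta[of i p] by (auto simp: fixed_point_def)

lemma fixed_point_iff:
  "fixed_point p \<longleftrightarrow> p \<in> carrier_vec (N + 1) \<and> sin (p $ 0) = 0 \<and> (\<forall>i\<in>{1..N}. sin (theta p i) = 0)"
  unfolding sin_theta_zero_iff fixed_point_def
  by (auto simp: Suc_le_eq)

lemma field_eq_0_iff:
  "field p = 0\<^sub>v (N + 1) \<longleftrightarrow> sin (p $ 0) = 0 \<and> (\<forall>i\<in>{1..N}. sin (theta p i) = 0)"
proof -
  have "field p = 0\<^sub>v (N + 1) \<longleftrightarrow> (\<forall>i\<le>N. field p $ i = 0)"
    by (auto simp: vec_eq_iff less_Suc_eq_le vehicle_field_def)
  also have "\<dots> \<longleftrightarrow> field p $ 0 = 0 \<and> (\<forall>i\<in>{1..N}. field p $ i = 0)"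
    by (auto simp: Suc_le_eq)
  also have "field p $ 0 = 0 \<longleftrightarrow> sin (p $ 0) = 0"
    using b_pos J_pos by (simp add: field_0)
  also have "(sin (p $ 0) = 0 \<and> (\<forall>i\<in>{1..N}. field p $ i = 0))
      \<longleftrightarrow> (sin (p $ 0) = 0 \<and> (\<forall>i\<in>{1..N}. sin (theta p i) = 0))"
  proof (rule conj_cong[OF refl], rule ball_cong[OF refl])
    fix i assume s: "sin (p $ 0) = 0" and i: "i \<in> {1..N}"
    have "cos (p $ 0) \<noteq> 0" using s sin_zero_abs_cos_one by force
    then show "field p $ i = 0 \<longleftrightarrow> sin (theta p i) = 0"
      using s i c_pos[of i] by (simp add: field_nth)
  qed
  finally show ?thesis .
qed

lemma fixed_points_field: "fixed_points (N + 1) field = {p. fixed_point p}"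
  unfolding fixed_points_def by (simp only: fixed_point_iff field_eq_0_iff)

lemma card_fixed_points: "card ({p. fixed_point p} // torus_rel (N + 1)) = 2 ^ (N + 1)"
proof -
  define v where "v S = vec (N + 1) (\<lambda>i. if i \<in> S then pi else 0)" for S
  let ?cls = "\<lambda>S. torus_rel (N + 1) `` {v S}"
  have fixed_v: "fixed_point (v S)" for S
    by (auto simp: fixed_point_def v_def)
  have cos_v: "cos (v S $ i) = (if i \<in> S then -1 else 1)" if "i \<le> N" for S i
    using that by (simp add: v_def)
  have rel_cos: "cos (x $ i) = cos (y $ i)" if "(x, y) \<in> torus_rel (N + 1)" "i \<le> N" for x y i
    using that by (auto simp: torus_rel_def less_Suc_eq_le intro: cos_rcong)
  have "inj_on ?cls (Pow {..N})"
  proof (rule inj_onI)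
    fix S S' assume S: "S \<in> Pow {..N}" "S' \<in> Pow {..N}" and eq: "?cls S = ?cls S'"
    then have "(v S, v S') \<in> torus_rel (N + 1)"
      using eq_equiv_class[OF eq equiv_torus_rel] by (simp add: v_def)
    then have "i \<in> S \<longleftrightarrow> i \<in> S'" if "i \<le> N" for i
      using rel_cos[of "v S" "v S'" i] cos_v[OF that] that by (auto split: if_splits)
    then show "S = S'" using S by blast
  qed
  moreover have "?cls ` Pow {..N} = {p. fixed_point p} // torus_rel (N + 1)"
  proof (intro equalityI subsetI)
    fix X assume "X \<in> ?cls ` Pow {..N}"
    then show "X \<in> {p. fixed_point p} // torus_rel (N + 1)"
      using fixed_v by (auto simp: quotient_def)
  next
    fix X assume "X \<in> {p. fixed_point p} // torus_rel (N + 1)"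
    then obtain p where p: "fixed_point p" and X: "X = torus_rel (N + 1) `` {p}"
      by (auto simp: quotient_def)
    define S where "S = {i. i \<le> N \<and> [p $ i = pi] (rmod (2 * pi))}"
    have "(v S, p) \<in> torus_rel (N + 1)"
      using p sin_zero_iff_rcong[of "p $ _"]
      by (auto simp: torus_rel_def v_def S_def fixed_point_def less_Suc_eq_le rcong_sym_iff)
    then have "X = ?cls S"
      using equiv_class_eq[OF equiv_torus_rel] X by metis
    then show "X \<in> ?cls ` Pow {..N}" by (auto simp: S_def)
  qed
  ultimately have "card ({p. fixed_point p} // torus_rel (N + 1)) = card (Pow {..N})"
    by (metis card_image)
  then show ?thesis by (simp add: card_Pow)
qed

subsection \<open>Linearization\<close>

text \<open>The eigenvalue of the linearization matrix that belongs to coordinate \<open>i\<close>.\<close>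
definition rate :: "real vec \<Rightarrow> nat \<Rightarrow> real" where
  "rate p i = (if i = 0 then - (b / J) * cos (p $ 0) else - cos (p $ 0) * cos (p $ i) / c i)"

definition jacobian :: "real vec \<Rightarrow> real mat" where
  "jacobian p = mat (N + 1) (N + 1) (\<lambda>(i, j).
     if i = 0 then - (b / J) * cos (p $ 0) * unit_vec (N + 1) j $ 0
     else (-1) ^ i / c i * cos (p $ 0) * cos (p $ i) * theta (unit_vec (N + 1) j) i
          - sqrt (\<Phi> p) / sqrt J * cos (p $ 0) * unit_vec (N + 1) j $ 0)"

text \<open>
  Every term of the field has a factor \<open>sin \<vartheta>\<close> or \<open>sin \<theta>\<^sub>i\<close> that vanishes at the fixed point, so
  its derivative there is the derivative of this factor times the value of the others. In
  particular the derivative of \<open>sqrt \<Phi>\<^sub>0\<close>, which exists since \<open>\<Phi>\<^sub>0 > 0\<close>, drops out.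
\<close>
lemma linearization_jacobian:
  assumes p: "fixed_point p"
  shows "linearization_matrix (N + 1) field p (jacobian p)"
  unfolding linearization_matrix_def
proof (intro conjI allI impI)
  show "jacobian p \<in> carrier_mat (N + 1) (N + 1)" by (simp add: jacobian_def)
  fix i j assume ij: "i < N + 1" "j < N + 1"
  define e :: "real vec" where "e = unit_vec (N + 1) j"
  have pc: "p \<in> carrier_vec (N + 1)" and sin0: "sin (p $ 0) = 0"
    using p by (auto simp: fixed_point_def)
  have ec: "e \<in> carrier_vec (N + 1)" by (simp add: e_def)
  have line0: "(p + s \<cdot>\<^sub>v e) $ 0 = p $ 0 + s * e $ 0" for s
    using pc ec by simp
  have line: "theta (p + s \<cdot>\<^sub>v e) k = theta p k + s * theta e k" if "k \<le> N" for s k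
    using theta_line[OF pc ec, of k s] that by simp
  show "((\<lambda>s. field (p + s \<cdot>\<^sub>v unit_vec (N + 1) j) $ i) has_real_derivative jacobian p $$ (i, j)) (at 0)"
  proof (cases "i = 0")
    case True
    have "((\<lambda>s. - (b / J) * sin (p $ 0 + s * e $ 0)) has_real_derivative
        - (b / J) * (cos (p $ 0 + 0 * e $ 0) * e $ 0)) (at 0)"
      by (rule derivative_eq_intros refl | simp)+
    moreover have "jacobian p $$ (i, j) = - (b / J) * cos (p $ 0) * e $ 0"
      using True ij by (simp add: jacobian_def e_def)
    ultimately show ?thesis
      unfolding True field_0 e_def[symmetric] line0 by (simp add: mult.assoc)
  next
    case False
    then have i: "1 \<le> i" "i \<le> N" using ij by auto
    have Phi_line: "\<Phi> (p + s \<cdot>\<^sub>v e) = (\<Sum>k=0..N. m k) +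
        (\<Sum>k=1..N. mu m I a c k * (sin (theta p k + s * theta e k))\<^sup>2)" for s
      unfolding Phi0_def by (intro arg_cong2[where f = "(+)"] sum.cong refl) (simp add: line)
    have "\<exists>D. ((\<lambda>s. \<Phi> (p + s \<cdot>\<^sub>v e)) has_real_derivative D) (at 0)"
      unfolding Phi_line by (rule exI, (rule derivative_intros | simp)+)
    then obtain D where D: "((\<lambda>s. \<Phi> (p + s \<cdot>\<^sub>v e)) has_real_derivative D) (at 0)" ..
    have p0: "p + 0 \<cdot>\<^sub>v e = p" using pc ec by auto
    define q where "q s = sqrt (\<Phi> (p + s \<cdot>\<^sub>v e))" for s
    obtain E where E: "(q has_real_derivative E) (at 0)"
      using DERIV_chain2[OF DERIV_real_sqrt[OF Phi_pos] D] unfolding q_def[abs_def] by blast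
    have q0: "q 0 = sqrt (\<Phi> p)" by (simp add: q_def p0)
    have "((\<lambda>s. K * cos (p $ 0 + s * e $ 0) * sin (theta p i + s * theta e i)
          - q s / R * sin (p $ 0 + s * e $ 0)) has_real_derivative
        K * cos (p $ 0) * cos (p $ i) * theta e i - sqrt (\<Phi> p) / R * cos (p $ 0) * e $ 0) (at 0)"
      if "R \<noteq> 0" for K R
      using that by (auto intro!: derivative_eq_intros E
          simp: q0 sin0 sin_theta_fixed[OF p] cos_theta_fixed[OF p] i field_simps)
    from this[of "sqrt J" "(-1) ^ i / c i"]
    have "((\<lambda>s. (-1) ^ i / c i * cos (p $ 0 + s * e $ 0) * sin (theta p i + s * theta e i)
          - q s / sqrt J * sin (p $ 0 + s * e $ 0)) has_real_derivative
        (-1) ^ i / c i * cos (p $ 0) * cos (p $ i) * theta e i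
          - sqrt (\<Phi> p) / sqrt J * cos (p $ 0) * e $ 0) (at 0)"
      using J_pos by simp
    moreover have "jacobian p $$ (i, j) = (-1) ^ i / c i * cos (p $ 0) * cos (p $ i) * theta e i
          - sqrt (\<Phi> p) / sqrt J * cos (p $ 0) * e $ 0"
      using False ij by (simp add: jacobian_def e_def)
    ultimately show ?thesis
      unfolding field_nth[OF i] e_def[symmetric] line0 line[OF i(2)] q_def by simp
  qed
qed

lemma complex_eigenvalues_jacobian:
  "complex_eigenvalues (jacobian p) = (\<lambda>i. complex_of_real (rate p i)) ` {..N}"
proof -
  have "complex_eigenvalues (jacobian p)
      = (\<lambda>i. complex_of_real (jacobian p $$ (i, i))) ` {..<N + 1}"
    by (rule complex_eigenvalues_lower_triangular)
      (auto simp: jacobian_def theta_unit_vec_later)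
  moreover have "jacobian p $$ (i, i) = rate p i" if "i < N + 1" for i
    using that theta_unit_vec_self[of i "N + 1"]
    by (simp add: jacobian_def rate_def flip: power_add)
  ultimately show ?thesis by (auto simp: image_iff less_Suc_eq_le)
qed

text \<open>
  If the coordinates before \<open>i\<close> agree with those of \<open>p\<close>, they are at rest, and \<open>\<theta>\<^sub>i\<close> is again
  \<open>\<plusminus>\<phi>\<^sub>i\<close> modulo \<open>2\<pi>\<close>. The \<open>i\<close>-th equation thus reduces to \<open>x\<^sub>i' = \<rho> sin (x\<^sub>i - p\<^sub>i)\<close>, where \<open>\<rho>\<close> is
  the \<open>i\<close>-th eigenvalue.
\<close>
lemma not_lyapunov_stable_if_rate_pos:
  assumes p: "fixed_point p" and i: "i \<le> N" and pos: "rate p i > 0"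
  shows "\<not> lyapunov_stable (N + 1) field p"
proof (rule not_lyapunov_stable_if_expanding_coordinate[where i = i and \<rho> = "rate p i"])
  have sin_p: "sin (p $ k) = 0" if "k \<le> N" for k
    using p that by (simp add: fixed_point_def)
  show "p \<in> carrier_vec (N + 1)" using p by (simp add: fixed_point_def)
  fix x :: "real vec" assume below: "\<forall>l<i. x $ l = p $ l"
  have sin_x: "sin (x $ l) = 0" if "l < i" for l
    using below sin_p[of l] that i by simp
  show "field x $ k = 0" if k: "k < i" for k
  proof (cases "k = 0")
    case True
    then show ?thesis using sin_x[OF k] by (simp add: field_0)
  next
    case False
    have "sin (theta x k) = 0"
      using sin_theta_cos_theta(1)[of k x] sin_x k by simp
    then show ?thesis using False k i sin_x[of 0] by (simp add: field_nth)
  qed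
  have shift: "sin (x $ i) = cos (p $ i) * sin (x $ i - p $ i)"
    using sin_add[of "p $ i" "x $ i - p $ i"] sin_p[OF i] by simp
  show "field x $ i = rate p i * sin (x $ i - p $ i)"
  proof (cases "i = 0")
    case True
    then show ?thesis using shift by (simp add: field_0 rate_def)
  next
    case False
    have "sin (theta x i) = (-1) ^ (i + 1) * sin (x $ i)"
      using sin_theta_cos_theta(1)[of i x] sin_x by simp
    then show ?thesis
      using False i below sin_x[of 0] shift by (simp add: field_nth rate_def flip: power_add)
  qed
qed (use i pos l1_lipschitz_field in auto)

subsection \<open>Types of the fixed points\<close>

lemma stable_nodeI:
  assumes p: "fixed_point p" and "\<And>i. i \<le> N \<Longrightarrow> rate p i < 0"
  shows "stable_node (N + 1) field p"
  unfolding stable_node_def fixed_points_field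
  using p linearization_jacobian[OF p] assms(2)
  by (auto intro!: exI[of _ "jacobian p"] simp: complex_eigenvalues_jacobian)

lemma unstable_nodeI:
  assumes p: "fixed_point p" and "\<And>i. i \<le> N \<Longrightarrow> rate p i > 0"
  shows "unstable_node (N + 1) field p"
  unfolding unstable_node_def fixed_points_field
  using p linearization_jacobian[OF p] assms(2)
  by (auto intro!: exI[of _ "jacobian p"] simp: complex_eigenvalues_jacobian)

lemma rate_nonzero:
  assumes "fixed_point p" and "i \<le> N" shows "rate p i \<noteq> 0"
proof -
  have "cos (p $ k) \<noteq> 0" if "k \<le> N" for k
    using assms(1) that sin_zero_abs_cos_one[of "p $ k"] by (auto simp: fixed_point_def)
  then show ?thesis
    using assms(2) b_pos J_pos c_pos[of i] by (auto simp: rate_def)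
qed

lemma saddle_typeI:
  assumes p: "fixed_point p"
    and i: "i \<le> N" "rate p i < 0" and j: "j \<le> N" "rate p j > 0"
  shows "saddle_type (N + 1) field p"
  unfolding saddle_type_def fixed_points_field
proof (intro conjI exI[of _ "jacobian p"])
  show "\<exists>z\<in>complex_eigenvalues (jacobian p). Re z < 0"
    "\<exists>z\<in>complex_eigenvalues (jacobian p). Re z > 0"
    using i j by (auto simp: complex_eigenvalues_jacobian)
  show "\<forall>z\<in>complex_eigenvalues (jacobian p). z \<in> \<real> \<and> z \<noteq> 0"
    using rate_nonzero[OF p] by (auto simp: complex_eigenvalues_jacobian)
qed (use p linearization_jacobian[OF p] in auto)

lemma node_criterion:
  assumes p: "p \<in> carrier_vec (N + 1)"
  shows "(p, 0\<^sub>v (N + 1)) \<in> torus_rel (N + 1) \<longleftrightarrow> (\<forall>i\<le>N. cos (p $ i) = 1)"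
    and "(p, pi \<cdot>\<^sub>v unit_vec (N + 1) 0) \<in> torus_rel (N + 1) \<longleftrightarrow>
      cos (p $ 0) = -1 \<and> (\<forall>i\<in>{1..N}. cos (p $ i) = 1)"
proof -
  show "(p, 0\<^sub>v (N + 1)) \<in> torus_rel (N + 1) \<longleftrightarrow> (\<forall>i\<le>N. cos (p $ i) = 1)"
    using p by (auto simp: torus_rel_def less_Suc_eq_le cos_eq_1_iff_rcong)
  have "(p, pi \<cdot>\<^sub>v unit_vec (N + 1) 0) \<in> torus_rel (N + 1) \<longleftrightarrow>
      (\<forall>i\<le>N. cos (p $ i) = (if i = 0 then -1 else 1))"
    using p by (auto simp: torus_rel_def less_Suc_eq_le cos_eq_1_iff_rcong cos_eq_minus_1_iff_rcong)
  also have "\<dots> \<longleftrightarrow> cos (p $ 0) = -1 \<and> (\<forall>i\<in>{1..N}. cos (p $ i) = 1)"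
    by (auto simp: Suc_le_eq split: if_splits)
  finally show "(p, pi \<cdot>\<^sub>v unit_vec (N + 1) 0) \<in> torus_rel (N + 1) \<longleftrightarrow>
      cos (p $ 0) = -1 \<and> (\<forall>i\<in>{1..N}. cos (p $ i) = 1)" .
qed

lemma cos_fixed_point:
  assumes "fixed_point p" and "i \<le> N" shows "cos (p $ i) = 1 \<or> cos (p $ i) = -1"
  using assms sin_zero_iff_rcong by (simp add: fixed_point_def cos_eq_1_iff_rcong cos_eq_minus_1_iff_rcong)

lemma fixed_point_if_cos:
  assumes "p \<in> carrier_vec (N + 1)" and "\<And>i. i \<le> N \<Longrightarrow> cos (p $ i) = 1 \<or> cos (p $ i) = -1"
  shows "fixed_point p"
  using assms sin_zero_iff_rcong by (simp add: fixed_point_def cos_eq_1_iff_rcong cos_eq_minus_1_iff_rcong)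

lemma stable_node_origin:
  assumes "p \<in> carrier_vec (N + 1)" and "(p, 0\<^sub>v (N + 1)) \<in> torus_rel (N + 1)"
  shows "stable_node (N + 1) field p"
proof (rule stable_nodeI)
  have cos1: "cos (p $ i) = 1" if "i \<le> N" for i
    using assms node_criterion(1) that by blast
  show "fixed_point p" using cos1 by (intro fixed_point_if_cos[OF assms(1)]) blast
  show "rate p i < 0" if "i \<le> N" for i
    using cos1 that b_pos J_pos c_pos[of i] by (simp add: rate_def)
qed

lemma unstable_node_reversed:
  assumes "p \<in> carrier_vec (N + 1)"
    and "(p, pi \<cdot>\<^sub>v unit_vec (N + 1) 0) \<in> torus_rel (N + 1)"
  shows "unstable_node (N + 1) field p"
proof (rule unstable_nodeI)
  have cos0: "cos (p $ 0) = -1" and cos1: "\<And>i. 1 \<le> i \<Longrightarrow> i \<le> N \<Longrightarrow> cos (p $ i) = 1"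
    using assms node_criterion(2)[of p] by auto
  show "fixed_point p"
    using cos0 cos1 by (intro fixed_point_if_cos[OF assms(1)]) (metis less_one not_le)
  show "rate p i > 0" if "i \<le> N" for i
    using cos0 cos1[of i] that b_pos J_pos c_pos[of i] by (simp add: rate_def)
qed

text \<open>
  Away from the two nodes some \<open>\<phi>\<^sub>i\<close> with \<open>i \<ge> 1\<close> is \<open>\<pi>\<close> modulo \<open>2\<pi>\<close>. The eigenvalues of \<open>\<vartheta>\<close> and of
  \<open>\<phi>\<^sub>i\<close> then have opposite signs, and the positive one drives the instability.
\<close>
lemma saddle_otherwise:
  assumes p: "fixed_point p" and not0: "(p, 0\<^sub>v (N + 1)) \<notin> torus_rel (N + 1)"
    and notpi: "(p, pi \<cdot>\<^sub>v unit_vec (N + 1) 0) \<notin> torus_rel (N + 1)"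
  shows "saddle_type (N + 1) field p \<and> \<not> lyapunov_stable (N + 1) field p"
proof -
  have pc: "p \<in> carrier_vec (N + 1)" using p by (simp add: fixed_point_def)
  have "\<exists>i\<in>{1..N}. cos (p $ i) \<noteq> 1"
  proof (rule ccontr)
    assume "\<not> ?thesis"
    then have all: "\<forall>i\<in>{1..N}. cos (p $ i) = 1" by blast
    then have "cos (p $ 0) \<noteq> -1" using notpi node_criterion(2)[OF pc] by blast
    then have "cos (p $ 0) = 1" using cos_fixed_point[OF p, of 0] by simp
    then have "\<forall>i\<le>N. cos (p $ i) = 1"
      using all by (metis atLeastAtMost_iff less_one not_le)
    then show False using not0 node_criterion(1)[OF pc] by blast
  qed
  then obtain i where i: "1 \<le> i" "i \<le> N" and cos_i: "cos (p $ i) = -1"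
    using cos_fixed_point[OF p] by (metis atLeastAtMost_iff)
  have rates: "rate p 0 = - (b / J) * cos (p $ 0)" "rate p i = cos (p $ 0) / c i"
    using i cos_i by (auto simp: rate_def)
  have pos: "b / J > 0" "c i > 0" using b_pos J_pos c_pos i by auto
  from cos_fixed_point[OF p, of 0] show ?thesis
  proof
    assume "cos (p $ 0) = 1"
    then have "rate p 0 < 0" "rate p i > 0" using pos by (simp_all add: rates)
    then show ?thesis
      using saddle_typeI[OF p] not_lyapunov_stable_if_rate_pos[OF p] i by blast
  next
    assume "cos (p $ 0) = -1"
    then have "rate p i < 0" "rate p 0 > 0" using pos by (simp_all add: rates)
    then show ?thesis
      using saddle_typeI[OF p] not_lyapunov_stable_if_rate_pos[OF p] i by blast
  qed simp
qed

end

theorem proposition1: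
  fixes N :: nat and m I a c :: "nat \<Rightarrow> real"
  assumes "N \<ge> 1"
    and "\<forall>i\<in>{0..N}. m i > 0"
    and "\<forall>i\<in>{0..N}. I i > 0"
    and "a 0 > 0"
    and "\<forall>i\<in>{1..N}. c i > 0"
  shows
    "(\<forall>x\<in>carrier_vec (N + 1). Phi0 N m I a c x > 0) \<and>
     fixed_points (N + 1) (vehicle_field N m I a c) =
       {x \<in> carrier_vec (N + 1).
          ([x $ 0 = 0] (rmod (2 * pi)) \<or> [x $ 0 = pi] (rmod (2 * pi))) \<and>
          (\<forall>i\<in>{1..N}. sin (theta x i) = 0)} \<and>
     card (fixed_points (N + 1) (vehicle_field N m I a c) // torus_rel (N + 1)) = 2 ^ (N + 1) \<and>
     (\<forall>p\<in>carrier_vec (N + 1).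
        (p, 0\<^sub>v (N + 1)) \<in> torus_rel (N + 1) \<longrightarrow>
        stable_node (N + 1) (vehicle_field N m I a c) p) \<and>
     (\<forall>p\<in>carrier_vec (N + 1).
        (p, pi \<cdot>\<^sub>v unit_vec (N + 1) 0) \<in> torus_rel (N + 1) \<longrightarrow>
        unstable_node (N + 1) (vehicle_field N m I a c) p) \<and>
     (\<forall>p\<in>fixed_points (N + 1) (vehicle_field N m I a c).
        (p, 0\<^sub>v (N + 1)) \<notin> torus_rel (N + 1) \<and>
        (p, pi \<cdot>\<^sub>v unit_vec (N + 1) 0) \<notin> torus_rel (N + 1) \<longrightarrow>
        saddle_type (N + 1) (vehicle_field N m I a c) p \<and>
        \<not> lyapunov_stable (N + 1) (vehicle_field N m I a c) p)"
proof -
  interpret wheeled_vehicle N m I a c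
    using assms by unfold_locales auto
  show ?thesis
  proof (intro conjI ballI impI)
    show "Phi0 N m I a c x > 0" for x by (rule Phi_pos)
    show "fixed_points (N + 1) field =
       {x \<in> carrier_vec (N + 1).
          ([x $ 0 = 0] (rmod (2 * pi)) \<or> [x $ 0 = pi] (rmod (2 * pi))) \<and>
          (\<forall>i\<in>{1..N}. sin (theta x i) = 0)}"
      unfolding fixed_points_field fixed_point_iff sin_zero_iff_rcong ..
    show "card (fixed_points (N + 1) field // torus_rel (N + 1)) = 2 ^ (N + 1)"
      unfolding fixed_points_field by (rule card_fixed_points)
  next
    fix p assume p: "p \<in> fixed_points (N + 1) field"
      and "(p, 0\<^sub>v (N + 1)) \<notin> torus_rel (N + 1) \<and>
        (p, pi \<cdot>\<^sub>v unit_vec (N + 1) 0) \<notin> torus_rel (N + 1)"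
    then have "saddle_type (N + 1) field p \<and> \<not> lyapunov_stable (N + 1) field p"
      using saddle_otherwise p[unfolded fixed_points_field] by blast
    then show "saddle_type (N + 1) field p" "\<not> lyapunov_stable (N + 1) field p"
      by blast+
  qed (fact stable_node_origin unstable_node_reversed)+
qed

end
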